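(* Let $R$ be an NI ring. Then $R$ is regularly nil clean if and only if $R$ is D-regularly nil clean.
   Context: All rings are associative with identity (not necessarily commutative). A ring $R$ is called NI if its set of nilpotent elements is a (two-sided) ideal of $R$. A ring $R$ is called regularly nil clean if for every $a\in R$ there exists an idempotent $e\in Ra$ such that $a(1-e)$ is nilpotent. A ring $R$ is called D-regularly nil clean if for every $a\in R$ there exists an idempotent $e\in aRa$ such that $a(1-e)$ is nilpotent. *)

theory Defs
  imports "HOL-Algebra.Ideal"
begin

definition nilpotents :: "('a, 'b) ring_scheme \<Rightarrow> 'a set" where
  "nilpotents R = {x \<in> carrier R. \<exists>n::nat. n > 0 \<and> x [^]\<^bsub>R\<^esub> n = \<zero>\<^bsub>R\<^esub>}"

definition idempotents :: "('a, 'b) ring_scheme \<Rightarrow> 'a set" where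
  "idempotents R = {e \<in> carrier R. e \<otimes>\<^bsub>R\<^esub> e = e}"

definition NI :: "('a, 'b) ring_scheme \<Rightarrow> bool" where
  "NI R \<longleftrightarrow> ideal (nilpotents R) R"

definition regularly_nil_clean :: "('a, 'b) ring_scheme \<Rightarrow> bool" where
  "regularly_nil_clean R \<longleftrightarrow>
    (\<forall>a \<in> carrier R. \<exists>e \<in> idempotents R.
       e \<in> {r \<otimes>\<^bsub>R\<^esub> a | r. r \<in> carrier R} \<and>
       a \<otimes>\<^bsub>R\<^esub> (\<one>\<^bsub>R\<^esub> \<ominus>\<^bsub>R\<^esub> e) \<in> nilpotents R)"

(* aRa is the set of products a r a, not the additive subgroup they generate
   (the two coincide by distributivity). *)
definition D_regularly_nil_clean :: "('a, 'b) ring_scheme \<Rightarrow> bool" where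
  "D_regularly_nil_clean R \<longleftrightarrow>
    (\<forall>a \<in> carrier R. \<exists>e \<in> idempotents R.
       e \<in> {a \<otimes>\<^bsub>R\<^esub> r \<otimes>\<^bsub>R\<^esub> a | r. r \<in> carrier R} \<and>
       a \<otimes>\<^bsub>R\<^esub> (\<one>\<^bsub>R\<^esub> \<ominus>\<^bsub>R\<^esub> e) \<in> nilpotents R)"

end

theory Submission
  imports Defs
begin

text \<open>
  Let \<open>e = r a\<close> be an idempotent. Replacing \<open>r\<close> by \<open>e r\<close>, also \<open>f = a r\<close> is idempotent.
  Idempotents are central modulo the ideal \<open>N\<close> of nilpotents, since \<open>e x (1 - e)\<close> and
  \<open>(1 - e) x e\<close> square to zero; hence \<open>e = r f a\<close> is congruent to \<open>r a f = e f\<close>. Thus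
  \<open>e f e\<close> differs from \<open>e\<close> by a nilpotent element, so it is invertible in the corner ring
  \<open>e R e\<close>. If \<open>u\<close> is its inverse there, then \<open>g = f u\<close> is an idempotent in \<open>a R a\<close> that is
  congruent to \<open>e\<close> modulo \<open>N\<close>, so \<open>a (1 - g)\<close> is nilpotent as soon as \<open>a (1 - e)\<close> is.
\<close>

context ring
begin

lemma minus_self:
  assumes "x \<in> carrier R"
  shows "x \<ominus> x = \<zero>"
  using assms by (simp add: minus_eq r_neg)

lemma minus_telescope:
  assumes "x \<in> carrier R" "y \<in> carrier R" "z \<in> carrier R"
  shows "(x \<ominus> y) \<oplus> (y \<ominus> z) = x \<ominus> z"
  using assms by (simp add: minus_eq a_assoc r_neg1)

lemma r_distr_minus:
  assumes "x \<in> carrier R" "y \<in> carrier R" "z \<in> carrier R"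
  shows "x \<otimes> (y \<ominus> z) = x \<otimes> y \<ominus> x \<otimes> z"
  using assms by (simp add: minus_eq r_distr r_minus)

lemma l_distr_minus:
  assumes "x \<in> carrier R" "y \<in> carrier R" "z \<in> carrier R"
  shows "(y \<ominus> z) \<otimes> x = y \<otimes> x \<ominus> z \<otimes> x"
  using assms by (simp add: minus_eq l_distr l_minus)

text \<open>The cofactor is the geometric sum of the powers of \<open>x\<close> with exponent below
  \<open>n\<close>, built one summand per induction step, starting from the empty sum. It commutes
  with \<open>x\<close>, so a single \<open>s\<close> serves on both sides.\<close>

lemma one_minus_factors_one_minus_pow:
  fixes n :: nat
  assumes "x \<in> carrier R"
  shows "\<exists>s \<in> carrier R. (\<one> \<ominus> x) \<otimes> s = \<one> \<ominus> x [^] n \<and> s \<otimes> (\<one> \<ominus> x) = \<one> \<ominus> x [^] n"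
proof (induction n)
  case 0
  then show ?case using assms by (intro bexI[of _ \<zero>]) (simp_all add: minus_self)
next
  case (Suc n)
  then obtain s where s: "s \<in> carrier R" "(\<one> \<ominus> x) \<otimes> s = \<one> \<ominus> x [^] n"
    "s \<otimes> (\<one> \<ominus> x) = \<one> \<ominus> x [^] n" by blast
  have "(\<one> \<ominus> x) \<otimes> x [^] n = x [^] n \<ominus> x [^] Suc n"
    using assms nat_pow_Suc2[of x n] by (simp add: l_distr_minus)
  moreover have "x [^] n \<otimes> (\<one> \<ominus> x) = x [^] n \<ominus> x [^] Suc n"
    using assms by (simp add: r_distr_minus)
  ultimately show ?case
    using assms s
    by (intro bexI[of _ "s \<oplus> x [^] n"]) (simp_all add: l_distr r_distr minus_telescope)
qed

text \<open>Once \<open>x [^] n\<close> vanishes, the geometric sum is a two-sided inverse.\<close>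

lemma one_minus_nilpotent_inverse:
  assumes "x \<in> nilpotents R"
  obtains v where "v \<in> carrier R" "(\<one> \<ominus> x) \<otimes> v = \<one>" "v \<otimes> (\<one> \<ominus> x) = \<one>"
proof -
  obtain n :: nat where "x \<in> carrier R" "x [^] n = \<zero>"
    using assms unfolding nilpotents_def by blast
  then show thesis
    using one_minus_factors_one_minus_pow[of x n] that by (auto simp: minus_eq)
qed

lemma square_zero_nilpotent:
  assumes "x \<in> carrier R" "x \<otimes> x = \<zero>"
  shows "x \<in> nilpotents R"
  using assms unfolding nilpotents_def
  by (auto intro!: exI[of _ "2::nat"] simp: numeral_2_eq_2)

lemma idempotents_commute_mod_nilpotents:
  assumes "ideal (nilpotents R) R" "e \<in> idempotents R" "x \<in> carrier R"
  shows "e \<otimes> x \<ominus> x \<otimes> e \<in> nilpotents R"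
proof -
  interpret N: ideal "nilpotents R" R by fact
  have e: "e \<in> carrier R" "e \<otimes> e = e" using assms(2) by (auto simp: idempotents_def)
  note x = assms(3)
  let ?d = "\<one> \<ominus> e"
  have z: "e \<otimes> ?d = \<zero>" "?d \<otimes> e = \<zero>"
    using e by (simp_all add: l_distr_minus r_distr_minus minus_self)
  have "(e \<otimes> x \<otimes> ?d) \<otimes> (e \<otimes> x \<otimes> ?d) = e \<otimes> x \<otimes> (?d \<otimes> e) \<otimes> x \<otimes> ?d"
    using e x by (simp add: m_assoc)
  then have p: "e \<otimes> x \<otimes> ?d \<in> nilpotents R"
    using e x z by (intro square_zero_nilpotent) auto
  have "(?d \<otimes> x \<otimes> e) \<otimes> (?d \<otimes> x \<otimes> e) = ?d \<otimes> x \<otimes> (e \<otimes> ?d) \<otimes> x \<otimes> e"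
    using e x by (simp add: m_assoc)
  then have q: "?d \<otimes> x \<otimes> e \<in> nilpotents R"
    using e x z by (intro square_zero_nilpotent) auto
  \<comment> \<open>Inserting \<open>e \<otimes> x \<otimes> e\<close> splits the commutator into
    the two off-diagonal Peirce components of \<open>x\<close>.\<close>
  have "e \<otimes> x \<ominus> x \<otimes> e = (e \<otimes> x \<ominus> e \<otimes> x \<otimes> e) \<oplus> (e \<otimes> x \<otimes> e \<ominus> x \<otimes> e)"
    using e x by (simp add: minus_telescope)
  also have "\<dots> = (e \<otimes> x \<otimes> ?d) \<ominus> (?d \<otimes> x \<otimes> e)"
    using e x by (simp add: l_distr r_distr l_minus r_minus minus_eq minus_add a_comm)
  finally show ?thesis using p q by (simp add: minus_eq)
qed

text \<open>The congruence to \<open>r \<otimes> a\<close> is what lets the new idempotent replace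
  the old one in the nilpotency condition.\<close>

lemma idempotent_in_principal_left_ideal_lift:
  assumes N: "ideal (nilpotents R) R"
    and a: "a \<in> carrier R" and r: "r \<in> carrier R" and idem: "r \<otimes> a \<in> idempotents R"
  obtains s where "s \<in> carrier R" "a \<otimes> s \<otimes> a \<in> idempotents R"
    "r \<otimes> a \<ominus> a \<otimes> s \<otimes> a \<in> nilpotents R"
proof -
  interpret N: ideal "nilpotents R" R by fact
  define e where "e = r \<otimes> a"
  define r' where "r' = e \<otimes> r"
  define f where "f = a \<otimes> r'"
  have e: "e \<in> carrier R" "e \<otimes> e = e" "e \<in> idempotents R"
    using idem by (auto simp: idempotents_def e_def)
  have r': "r' \<in> carrier R" and f: "f \<in> carrier R"
    using e a r by (auto simp: r'_def f_def)
  have r'a: "r' \<otimes> a = e" and er': "e \<otimes> r' = r'"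
    using e a r by (simp_all add: r'_def m_assoc flip: e_def)
      (simp add: m_assoc[symmetric])
  have "f \<otimes> f = a \<otimes> ((r' \<otimes> a) \<otimes> r')"
    using a r' by (simp add: f_def m_assoc)
  then have ff: "f \<otimes> f = f" by (simp add: r'a er' f_def)
  then have f_idem: "f \<in> idempotents R" using f by (simp add: idempotents_def)
  \<comment> \<open>Left multiplication by \<open>r'\<close> turns the commutator of
    \<open>f\<close> and \<open>a\<close>, which is nilpotent, into
    \<open>e \<ominus> e \<otimes> f\<close>.\<close>
  have "r' \<otimes> (f \<otimes> a) = (r' \<otimes> a) \<otimes> (r' \<otimes> a)"
    using a r' by (simp add: f_def m_assoc)
  moreover have "r' \<otimes> (a \<otimes> f) = e \<otimes> f"
    using a r' f by (simp add: m_assoc[symmetric] r'a)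
  ultimately have "e \<ominus> e \<otimes> f = r' \<otimes> (f \<otimes> a \<ominus> a \<otimes> f)"
    using a r' f e by (simp add: r_distr_minus r'a)
  then have eef: "e \<ominus> e \<otimes> f \<in> nilpotents R"
    using idempotents_commute_mod_nilpotents[OF N f_idem a] r' by (simp add: N.I_l_closed)
  \<comment> \<open>The right factor \<open>e\<close> moves the difference into the corner ring of
    \<open>e\<close>.\<close>
  define n where "n = (e \<ominus> e \<otimes> f) \<otimes> e"
  have nN: "n \<in> nilpotents R" using eef e by (simp add: n_def N.I_r_closed)
  then have n: "n \<in> carrier R" by (rule N.a_Hcarr)
  have n_eq: "n = e \<ominus> e \<otimes> f \<otimes> e"
    using e f by (simp add: n_def l_distr_minus)
  \<comment> \<open>The corner inverse comes from a unit of the whole ring: \<open>x\<close> agrees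
    with \<open>e \<otimes> f \<otimes> e\<close> after multiplication by \<open>e\<close> on either
    side, so \<open>e \<otimes> v\<close> is the element \<open>u\<close> of the overview.\<close>
  define x where "x = \<one> \<ominus> n"
  obtain v where v: "v \<in> carrier R" "x \<otimes> v = \<one>" "v \<otimes> x = \<one>"
    using one_minus_nilpotent_inverse[OF nN] unfolding x_def by blast
  have x: "x \<in> carrier R" using n by (simp add: x_def)
  have "e \<otimes> n = n" "n \<otimes> e = n"
    using e f by (simp_all add: n_eq l_distr_minus r_distr_minus m_assoc)
      (simp add: m_assoc[symmetric])
  moreover have "e \<ominus> n = e \<otimes> f \<otimes> e"
    using e f by (simp add: n_eq minus_eq minus_add a_assoc[symmetric] r_neg)
  ultimately have ex: "e \<otimes> x = e \<otimes> f \<otimes> e" and xe: "x \<otimes> e = e \<otimes> f \<otimes> e"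
    using e n by (simp_all add: x_def r_distr_minus l_distr_minus)
  \<comment> \<open>The inverse \<open>v\<close> commutes with \<open>e\<close> because
    \<open>x\<close> does.\<close>
  have "v \<otimes> e = v \<otimes> (e \<otimes> x) \<otimes> v"
    using v e x by (simp add: m_assoc)
  also have "\<dots> = (v \<otimes> x) \<otimes> e \<otimes> v"
    unfolding ex xe[symmetric] using v(1) e x by (simp add: m_assoc)
  finally have ve: "v \<otimes> e = e \<otimes> v" using v e by simp
  define g where "g = f \<otimes> e \<otimes> v"
  have g: "g \<in> carrier R" using e f v by (simp add: g_def)
  \<comment> \<open>Moving \<open>v\<close> to the left of \<open>e\<close> exposes
    \<open>e \<otimes> f \<otimes> e\<close>, that is \<open>x \<otimes> e\<close>, whose factor
    \<open>x\<close> is cancelled by \<open>v\<close>.\<close>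
  have "g \<otimes> g = f \<otimes> (v \<otimes> (e \<otimes> f \<otimes> e)) \<otimes> v"
    using e f v ve by (simp add: g_def m_assoc) (simp add: m_assoc[symmetric] ve)
  also have "\<dots> = f \<otimes> ((v \<otimes> x) \<otimes> e) \<otimes> v"
    unfolding xe[symmetric] using v(1) e x f by (simp add: m_assoc)
  finally have gg: "g \<otimes> g = g" using v e f by (simp add: g_def)
  \<comment> \<open>The left factor \<open>a\<close> comes from \<open>f\<close>, the right one from
    \<open>e\<close> once \<open>v\<close> has been moved to its left.\<close>
  have g_eq: "g = a \<otimes> (r' \<otimes> v \<otimes> r) \<otimes> a"
    using a r r' v e f ve by (simp add: g_def m_assoc flip: ve) (simp add: f_def e_def m_assoc)
  have efe: "e \<ominus> f \<otimes> e \<in> nilpotents R"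
  proof -
    have "e \<otimes> f \<ominus> f \<otimes> e \<in> nilpotents R"
      using idempotents_commute_mod_nilpotents[OF N e(3) f] .
    with eef have "(e \<ominus> e \<otimes> f) \<oplus> (e \<otimes> f \<ominus> f \<otimes> e) \<in> nilpotents R" by blast
    then show ?thesis using e f by (simp add: minus_telescope)
  qed
  have "f \<otimes> e \<ominus> g \<in> nilpotents R"
  proof -
    have "f \<otimes> e \<ominus> g = f \<otimes> e \<otimes> (\<one> \<ominus> v)"
      using e f v by (simp add: g_def r_distr_minus)
    \<comment> \<open>Modulo nilpotents \<open>x\<close> is \<open>\<one>\<close>, hence so is its
      inverse \<open>v\<close>.\<close>
    also have "\<one> \<ominus> v = (x \<ominus> \<one>) \<otimes> v" using x v by (simp add: l_distr_minus)
    also have "x \<ominus> \<one> = \<ominus> n"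
      using n by (simp add: x_def minus_eq a_comm r_neg1)
    finally show ?thesis
      using nN e f v by (simp add: N.I_l_closed N.I_r_closed)
  qed
  with efe have "(e \<ominus> f \<otimes> e) \<oplus> (f \<otimes> e \<ominus> g) \<in> nilpotents R" by blast
  then have "e \<ominus> g \<in> nilpotents R" using e f g by (simp add: minus_telescope)
  then show thesis
    using that[of "r' \<otimes> v \<otimes> r"] gg g r r' v g_eq by (simp add: idempotents_def e_def)
qed

end

theorem theorem3p3:
  fixes R :: "('a, 'b) ring_scheme"
  assumes "ring R" and "NI R"
  shows "regularly_nil_clean R \<longleftrightarrow> D_regularly_nil_clean R"
proof
  interpret ring R by fact
  have N: "ideal (nilpotents R) R" using assms(2) by (simp add: NI_def)
  interpret N: ideal "nilpotents R" R by fact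
  {
    assume D: "D_regularly_nil_clean R"
    show "regularly_nil_clean R"
      unfolding regularly_nil_clean_def
    proof
      fix a assume a: "a \<in> carrier R"
      then obtain e r where "e \<in> idempotents R" "r \<in> carrier R"
        "e = a \<otimes>\<^bsub>R\<^esub> r \<otimes>\<^bsub>R\<^esub> a" "a \<otimes>\<^bsub>R\<^esub> (\<one>\<^bsub>R\<^esub> \<ominus>\<^bsub>R\<^esub> e) \<in> nilpotents R"
        using D unfolding D_regularly_nil_clean_def by blast
      \<comment> \<open>The same \<open>e\<close> works, with \<open>a \<otimes> r\<close> as the
        left multiplier of \<open>a\<close>.\<close>
      then show "\<exists>e \<in> idempotents R. e \<in> {r \<otimes>\<^bsub>R\<^esub> a | r. r \<in> carrier R} \<and>
          a \<otimes>\<^bsub>R\<^esub> (\<one>\<^bsub>R\<^esub> \<ominus>\<^bsub>R\<^esub> e) \<in> nilpotents R"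
        using a by blast
    qed
  next
    assume L: "regularly_nil_clean R"
    show "D_regularly_nil_clean R"
      unfolding D_regularly_nil_clean_def
    proof
      fix a assume a: "a \<in> carrier R"
      then obtain r where r: "r \<in> carrier R" "r \<otimes>\<^bsub>R\<^esub> a \<in> idempotents R"
        and ae: "a \<otimes>\<^bsub>R\<^esub> (\<one>\<^bsub>R\<^esub> \<ominus>\<^bsub>R\<^esub> r \<otimes>\<^bsub>R\<^esub> a) \<in> nilpotents R"
        using L unfolding regularly_nil_clean_def by blast
      obtain s where s: "s \<in> carrier R" "a \<otimes>\<^bsub>R\<^esub> s \<otimes>\<^bsub>R\<^esub> a \<in> idempotents R"
        and d: "r \<otimes>\<^bsub>R\<^esub> a \<ominus>\<^bsub>R\<^esub> a \<otimes>\<^bsub>R\<^esub> s \<otimes>\<^bsub>R\<^esub> a \<in> nilpotents R"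
        using idempotent_in_principal_left_ideal_lift[OF N a r] by blast
      \<comment> \<open>Exchanging the idempotent changes the product only by a left multiple of the
        nilpotent difference \<open>d\<close>.\<close>
      have "a \<otimes>\<^bsub>R\<^esub> (\<one>\<^bsub>R\<^esub> \<ominus>\<^bsub>R\<^esub> a \<otimes>\<^bsub>R\<^esub> s \<otimes>\<^bsub>R\<^esub> a) =
          a \<otimes>\<^bsub>R\<^esub> (\<one>\<^bsub>R\<^esub> \<ominus>\<^bsub>R\<^esub> r \<otimes>\<^bsub>R\<^esub> a) \<oplus>\<^bsub>R\<^esub>
          a \<otimes>\<^bsub>R\<^esub> (r \<otimes>\<^bsub>R\<^esub> a \<ominus>\<^bsub>R\<^esub> a \<otimes>\<^bsub>R\<^esub> s \<otimes>\<^bsub>R\<^esub> a)"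
        using a r s by (simp add: minus_telescope r_distr[symmetric])
      also have "\<dots> \<in> nilpotents R"
        using ae d a by (simp add: N.I_l_closed)
      finally show "\<exists>e \<in> idempotents R. e \<in> {a \<otimes>\<^bsub>R\<^esub> r \<otimes>\<^bsub>R\<^esub> a | r. r \<in> carrier R} \<and>
          a \<otimes>\<^bsub>R\<^esub> (\<one>\<^bsub>R\<^esub> \<ominus>\<^bsub>R\<^esub> e) \<in> nilpotents R"
        using s by blast
    qed
  }
qed

end
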